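(* Let $\beta\in[0,1]$. If $f\in\mathcal{A}_\beta$ and $g\in\mathcal{K}$, then $f*g\in\mathcal{A}_\beta$.
   Context: $\mathbb{D}=\{z\in\mathbb{C}:|z|<1\}$. $\mathcal{A}$ is the class of functions $f$ holomorphic in $\mathbb{D}$ with $f(0)=0$ and $f'(0)=1$. $\mathcal{K}\subset\mathcal{A}$ is the class of convex functions, i.e. univalent $g\in\mathcal{A}$ such that $g(\mathbb{D})$ is a convex set. For $\beta\in[0,1]$, $$\mathcal{A}_\beta=\left\{f\in\mathcal{A}:\operatorname{Re}\left(\beta\frac{f(z)}{z}+(1-\beta)f'(z)\right)>0 \text{ for all } z\in\mathbb{D}\right\},$$ where $f(z)/z$ is given the value $1$ at $z=0$. The Hadamard product (convolution) of $f(z)=\sum_{n\ge0}a_nz^n$ and $g(z)=\sum_{n\ge0}b_nz^n$ is $(f*g)(z)=\sum_{n\ge0}a_nb_nz^n$. *)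

theory Defs
  imports "HOL-Complex_Analysis.Complex_Analysis"
begin

text \<open>
  Functions on the unit disc are represented by total functions on the complex numbers of which
  only the values on \<^term>\<open>ball 0 1 :: complex set\<close> matter.
\<close>

abbreviation unit_disc :: "complex set" where
  "unit_disc \<equiv> ball 0 1"

definition normalized_functions :: "(complex \<Rightarrow> complex) set" where
  "normalized_functions = {f. f holomorphic_on unit_disc \<and> f 0 = 0 \<and> deriv f 0 = 1}"

definition convex_functions :: "(complex \<Rightarrow> complex) set" where
  "convex_functions =
     {g \<in> normalized_functions. inj_on g unit_disc \<and> convex (g ` unit_disc)}"

definition class_A :: "real \<Rightarrow> (complex \<Rightarrow> complex) set" where
  "class_A \<beta> =
     {f \<in> normalized_functions. \<forall>z\<in>unit_disc.
        Re (of_real \<beta> * (if z = 0 then 1 else f z / z) + of_real (1 - \<beta>) * deriv f z) > 0}"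

text \<open>
  The coefficients are those of the Taylor expansions at the origin. For functions holomorphic on
  the unit disc the series converges there; outside the disc the value is irrelevant.
\<close>

definition hadamard_product :: "(complex \<Rightarrow> complex) \<Rightarrow> (complex \<Rightarrow> complex) \<Rightarrow> complex \<Rightarrow> complex" where
  "hadamard_product f g z =
     (\<Sum>n. fps_nth (fps_expansion f 0) n * fps_nth (fps_expansion g 0) n * z ^ n)"

lemma hadamard_product_eq:
  assumes f: "\<And>z. z \<in> unit_disc \<Longrightarrow> (\<lambda>n. a n * z ^ n) sums f z"
    and g: "\<And>z. z \<in> unit_disc \<Longrightarrow> (\<lambda>n. b n * z ^ n) sums g z"
  shows "hadamard_product f g z = (\<Sum>n. a n * b n * z ^ n)"
proof -
  have *: "fps_nth (fps_expansion h 0) n = c n"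
    if h: "\<And>z. z \<in> unit_disc \<Longrightarrow> (\<lambda>n. c n * z ^ n) sums h z" for h c n
  proof -
    define F where "F = Abs_fps c"
    have sm: "summable (\<lambda>n. fps_nth F n * z ^ n)" if "norm z < 1" for z
      using h[of z] that by (auto simp: F_def sums_iff)
    have "fps_conv_radius F \<ge> 1"
      unfolding fps_conv_radius_def
      by (rule conv_radius_geI_ex') (use sm in \<open>auto simp: less_imp_le\<close>)
    moreover have "eventually (\<lambda>z. eval_fps F z = h z) (nhds 0)"
      using h by (intro eventually_nhds_in_open[of unit_disc 0, THEN eventually_mono])
        (auto simp: eval_fps_def F_def sums_iff)
    ultimately have "h has_fps_expansion F"
      unfolding has_fps_expansion_def by (auto intro: less_le_trans[of 0 1])
    then show ?thesis
      by (simp add: fps_expansion_eqI F_def)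
  qed
  have "fps_nth (fps_expansion f 0) n = a n" "fps_nth (fps_expansion g 0) n = b n" for n
    by (rule *, erule f, rule *, erule g)
  then show ?thesis
    by (simp add: hadamard_product_def)
qed

end

theory Submission
  imports Defs
begin

text \<open>
  The condition defining \<^term>\<open>class_A \<beta>\<close> says that a certain functional of \<open>f\<close> has positive real
  part, and this functional multiplies the Taylor coefficients of \<open>f(z)/z\<close> by numbers that depend
  only on \<open>\<beta>\<close> and the index. It therefore commutes with convolution: the functional of \<open>f * g\<close> is
  the convolution of the functional \<open>F\<close> of \<open>f\<close> with \<open>G(z) = g(z)/z\<close>. Two facts
  finish the proof.

  The first is the Marx--Strohhaecker inequality \<open>Re (g(z)/z) \<ge> 1/2\<close> for convex \<open>g\<close>
  (\<open>convex_quotient_Re_ge_half\<close>). By convexity of the image, the function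
  \<open>u \<mapsto> g\<^sup>-\<^sup>1((1-t) g(u) + t g(xu))\<close> is a self-map of the disc fixing \<open>0\<close>, so Schwarz' lemma bounds
  it by \<open>|u|\<close>; differentiating at \<open>t = 0\<close> gives
  \<open>Re ((g(z) - g(xz)) / (z g'(z))) \<ge> 0\<close> for all \<open>x\<close> in the disc (\<open>convex_chord_Re_nonneg\<close>). As a
  function of \<open>x\<close> this quotient maps the disc to the right half-plane and vanishes at the boundary
  point \<open>1\<close> with derivative \<open>-1\<close>. Julia's boundary form of Schwarz' lemma (\<open>Julia_half_plane\<close>)
  turns this into information at \<open>x = 0\<close>, namely \<open>Re (z g'(z)/g(z)) \<ge> 1/2\<close>. Comparing the
  derivative of \<open>w = 1 - z/g(z)\<close> at a point where \<open>|w|\<close> is maximal with that of a rotation and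
  dilation (\<open>Jack_bound\<close>) yields \<open>|w| \<le> 1\<close>, which is the inequality sought.

  The second (\<open>Re_hadamard_nonneg\<close>) is that convolution with a function \<open>G\<close> satisfying \<open>G(0) = 1\<close> and
  \<open>Re G \<ge> 1/2\<close> preserves nonnegativity of the real part, because the convolution is an average of
  the values of \<open>F\<close> with the nonnegative weight \<open>2 Re G - 1\<close>. The maximum principle makes the final
  inequality strict.
\<close>

section \<open>Positivity and Schwarz-type lemmas\<close>

text \<open>
  Two curves that start at equal distance from the origin, one staying at least as far out as the
  other: comparing the derivatives of the squared norms at the start compares the radial speeds.
  This is how bounds of Schwarz type are turned into inequalities between derivatives below.
\<close>
lemma inner_deriv_le_of_norm_le:
  fixes c e :: "real \<Rightarrow> 'a::real_inner"
  assumes c: "(c has_vector_derivative v) (at 0)" and e: "(e has_vector_derivative w) (at 0)"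
    and eq: "norm (c 0) = norm (e 0)"
    and le: "eventually (\<lambda>t. norm (c t) \<le> norm (e t)) (at_right 0)"
  shows "inner (c 0) v \<le> inner (e 0) w"
proof (rule ccontr)
  assume neg: "\<not> inner (c 0) v \<le> inner (e 0) w"
  define f where "f t = inner (c t) (c t) - inner (e t) (e t)" for t
  have "(f has_real_derivative 2 * (inner (c 0) v - inner (e 0) w)) (at 0)"
    unfolding f_def has_field_derivative_def
    using c e unfolding has_vector_derivative_def
    by (auto intro!: derivative_eq_intros simp: inner_commute algebra_simps)
  then obtain d where "d > 0" and d: "\<And>h. 0 < h \<Longrightarrow> h < d \<Longrightarrow> f 0 < f h"
    using DERIV_pos_inc_right[of f "2 * (inner (c 0) v - inner (e 0) w)" 0] neg by auto
  have "eventually (\<lambda>t. t \<in> {0<..<d}) (at_right 0)"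
    using \<open>d > 0\<close> by (rule eventually_at_right_real)
  with le have "eventually (\<lambda>t::real. False) (at_right 0)"
  proof eventually_elim
    case (elim t)
    have "f 0 = 0"
      using eq by (simp add: f_def norm_eq_sqrt_inner)
    moreover have "f t \<le> 0"
      using elim by (simp add: f_def norm_le)
    ultimately show False
      using d[of t] elim by simp
  qed
  then show False by simp
qed

text \<open>
  If \<open>Re h\<close> vanished at some point, \<open>exp (-h)\<close> would attain its maximal modulus \<open>1\<close> inside the disc
  and be constant, contradicting its value at the origin.
\<close>
lemma Re_pos_of_Re_nonneg:
  assumes hol: "h holomorphic_on unit_disc" and nonneg: "\<And>z. z \<in> unit_disc \<Longrightarrow> 0 \<le> Re (h z)"
    and pos: "0 < Re (h 0)" and z: "z \<in> unit_disc"
  shows "0 < Re (h z)"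
proof (rule ccontr)
  assume "\<not> 0 < Re (h z)"
  with nonneg[OF z] have z0: "Re (h z) = 0" by simp
  have "(\<lambda>u. exp (- h u)) constant_on unit_disc"
  proof (rule maximum_modulus_principle[where U = unit_disc and \<xi> = z])
    show "(\<lambda>u. exp (- h u)) holomorphic_on unit_disc"
      by (intro holomorphic_intros hol)
  qed (use nonneg z z0 in auto)
  then have "exp (- h 0) = exp (- h z)"
    using z by (auto simp: constant_on_def)
  then have "cmod (exp (- h 0)) = cmod (exp (- h z))" by simp
  then show False using pos z0 by simp
qed

text \<open>
  Schwarz' lemma under the non-strict bound, obtained by applying the strict one to \<open>s f\<close> for
  \<open>s < 1\<close>.
\<close>
lemma norm_le_of_norm_le_1:
  assumes hol: "f holomorphic_on unit_disc" and f0: "f 0 = 0"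
    and le: "\<And>z. z \<in> unit_disc \<Longrightarrow> norm (f z) \<le> 1" and z: "z \<in> unit_disc"
  shows "norm (f z) \<le> norm z"
proof (rule field_le_mult_one_interval)
  fix s :: real assume s: "0 < s" "s < 1"
  have "norm (of_real s * f z) \<le> norm z"
  proof (rule Schwarz_Lemma(1))
    show "(\<lambda>u. of_real s * f u) holomorphic_on unit_disc"
      by (intro holomorphic_intros hol)
    fix u :: complex assume "norm u < 1"
    then have "s * norm (f u) \<le> s * 1"
      using le[of u] s by (intro mult_left_mono) auto
    with s have "s * norm (f u) < 1" by linarith
    with s show "norm (of_real s * f u) < 1"
      by (simp add: norm_mult)
  qed (use f0 z in auto)
  with s show "s * norm (f z) \<le> norm z"
    by (simp add: norm_mult)
qed

lemma cmod_diff_sum_cnj: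
  "(cmod (u + cnj a))\<^sup>2 - (cmod (u - a))\<^sup>2 = 4 * Re u * Re a"
  by (simp only: cmod_power2) (simp add: power2_eq_square algebra_simps)

text \<open>
  Schwarz' lemma for \<open>A\<close> followed by the Cayley map \<open>u \<mapsto> (u - A 0) / (u + cnj (A 0))\<close> from the
  right half-plane to the disc.
\<close>
lemma Schwarz_Pick_half_plane:
  assumes hol: "A holomorphic_on unit_disc" and nonneg: "\<And>x. x \<in> unit_disc \<Longrightarrow> 0 \<le> Re (A x)"
    and pos: "0 < Re (A 0)" and x: "x \<in> unit_disc"
  shows "(1 - (norm x)\<^sup>2) * (cmod (A x + cnj (A 0)))\<^sup>2 \<le> 4 * Re (A x) * Re (A 0)"
proof -
  define S where "S u = (A u - A 0) / (A u + cnj (A 0))" for u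
  have nz: "A u + cnj (A 0) \<noteq> 0" if "u \<in> unit_disc" for u
    using nonneg[OF that] pos by (auto simp: complex_eq_iff)
  have le: "cmod (A u - A 0) \<le> cmod (A u + cnj (A 0))" if "u \<in> unit_disc" for u
  proof -
    have "0 \<le> 4 * Re (A u) * Re (A 0)"
      using nonneg[OF that] pos by simp
    then have "(cmod (A u - A 0))\<^sup>2 \<le> (cmod (A u + cnj (A 0)))\<^sup>2"
      using cmod_diff_sum_cnj[of "A u" "A 0"] by linarith
    then show ?thesis by (rule power2_le_imp_le) simp
  qed
  have "norm (S x) \<le> norm x"
  proof (rule norm_le_of_norm_le_1[OF _ _ _ x])
    show "S holomorphic_on unit_disc"
      unfolding S_def using nz by (intro holomorphic_intros hol) auto
    show "norm (S u) \<le> 1" if "u \<in> unit_disc" for u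
      using le[OF that] nz[OF that] by (simp add: S_def norm_divide divide_le_eq)
  qed (simp add: S_def)
  then have "cmod (A x - A 0) \<le> norm x * cmod (A x + cnj (A 0))"
    using nz[OF x] by (simp add: S_def norm_divide divide_le_eq)
  then have "(cmod (A x - A 0))\<^sup>2 \<le> (norm x)\<^sup>2 * (cmod (A x + cnj (A 0)))\<^sup>2"
    by (metis norm_ge_zero power_mono power_mult_distrib)
  then show ?thesis
    using cmod_diff_sum_cnj[of "A x" "A 0"] by (simp add: algebra_simps)
qed

text \<open>
  A map into the right half-plane that sends the boundary point \<open>1\<close> to the boundary point \<open>0\<close>
  cannot vanish there too slowly compared with its value at the origin. Dividing the Schwarz--Pick
  inequality at real \<open>t < 1\<close> by \<open>1 - t\<close> and letting \<open>t\<close> tend to \<open>1\<close> replaces \<open>Re (A t)\<close> by the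
  derivative and \<open>A t\<close> by \<open>0\<close>.
\<close>
lemma Julia_half_plane:
  assumes hol: "A holomorphic_on unit_disc" and nonneg: "\<And>x. x \<in> unit_disc \<Longrightarrow> 0 \<le> Re (A x)"
    and pos: "0 < Re (A 0)"
    and A1: "A 1 = 0" and der: "(A has_field_derivative - of_real d) (at 1)"
  shows "(cmod (A 0))\<^sup>2 \<le> 2 * d * Re (A 0)"
proof -
  define a where "a = A 0"
  have lim: "filterlim complex_of_real (at 1) (at_left 1)"
    unfolding filterlim_at
    by (auto simp: eventually_at_filter intro!: tendsto_eq_intros)
  have q: "((\<lambda>t. A (complex_of_real t) / (1 - of_real t)) \<longlongrightarrow> of_real d) (at_left 1)"
  proof -
    have "((\<lambda>x. (A x - A 1) / (x - 1)) \<longlongrightarrow> - of_real d) (at 1)"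
      using der by (simp add: has_field_derivative_iff)
    from tendsto_minus[OF filterlim_compose[OF this lim]] show ?thesis
      by (simp add: A1 minus_divide_right)
  qed
  have c: "((\<lambda>t. A (complex_of_real t)) \<longlongrightarrow> 0) (at_left 1)"
    using filterlim_compose[OF _ lim] DERIV_isCont[OF der] A1 by (auto simp: isCont_def)
  have "2 * (cmod (0 + cnj a))\<^sup>2 \<le> 4 * Re (of_real d) * Re a"
  proof (rule tendsto_le[OF trivial_limit_at_left_real])
    show "((\<lambda>t. 4 * Re (A (complex_of_real t) / (1 - of_real t)) * Re a)
            \<longlongrightarrow> 4 * Re (of_real d) * Re a) (at_left 1)"
      by (intro tendsto_intros q)
    show "((\<lambda>t. (1 + t) * (cmod (A (complex_of_real t) + cnj a))\<^sup>2)
            \<longlongrightarrow> 2 * (cmod (0 + cnj a))\<^sup>2) (at_left 1)"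
      by (rule tendsto_eq_intros c refl | simp)+
    have "eventually (\<lambda>t::real. t \<in> {0<..<1}) (at_left 1)"
      by (rule eventually_at_left_real) simp
    then show "eventually (\<lambda>t. (1 + t) * (cmod (A (complex_of_real t) + cnj a))\<^sup>2
        \<le> 4 * Re (A (complex_of_real t) / (1 - of_real t)) * Re a) (at_left 1)"
    proof eventually_elim
      case (elim t)
      have "(1 - t\<^sup>2) * (cmod (A (of_real t) + cnj a))\<^sup>2 \<le> 4 * Re (A (of_real t)) * Re a"
        using Schwarz_Pick_half_plane[OF hol nonneg pos, of "of_real t"] elim by (simp add: a_def)
      moreover have "1 - t\<^sup>2 = (1 + t) * (1 - t)"
        by (simp add: power2_eq_square algebra_simps)
      moreover have "Re (A (of_real t) / (1 - of_real t)) = Re (A (of_real t)) / (1 - t)"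
        by (metis Re_divide_of_real of_real_1 of_real_diff)
      ultimately show ?case
        using elim by (simp add: field_simps)
    qed
  qed
  then show ?thesis by (simp add: a_def)
qed

section \<open>Convex functions are starlike of order one half\<close>

lemma inner_mult_left_cnj: "inner z (z * w) = (cmod z)\<^sup>2 * Re w"
  unfolding cmod_power2 by (simp add: inner_complex_def power2_eq_square algebra_simps)

text \<open>
  By Schwarz' lemma, \<open>g\<^sup>-\<^sup>1\<close> maps the segment from \<open>g(z)\<close> to \<open>g(xz)\<close> into the disc of radius \<open>|z|\<close>.
  Hence \<open>g\<^sup>-\<^sup>1\<close> of a point starting at \<open>g(z)\<close> and moving along this segment cannot initially move
  outwards from \<open>z\<close>, and its initial velocity is \<open>(g(xz) - g(z)) / g'(z)\<close>.
\<close>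
lemma convex_chord_Re_nonneg:
  assumes hol: "g holomorphic_on unit_disc" and g0: "g 0 = 0"
    and inj: "inj_on g unit_disc" and conv: "convex (g ` unit_disc)"
    and z: "z \<in> unit_disc" "z \<noteq> 0" and x: "x \<in> unit_disc"
  shows "0 \<le> Re ((g z - g (x * z)) / (z * deriv g z))"
proof -
  obtain k where k_hol: "k holomorphic_on g ` unit_disc"
    and k_der: "\<And>u. u \<in> unit_disc \<Longrightarrow> deriv g u * deriv k (g u) = 1"
    and k: "\<And>u. u \<in> unit_disc \<Longrightarrow> k (g u) = u"
    using holomorphic_has_inverse[OF hol open_ball inj] by blast
  have D_open: "open (g ` unit_disc)"
    by (rule open_mapping_thm3[OF hol open_ball inj])
  have mem: "x * u \<in> unit_disc" if "u \<in> unit_disc" for u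
    using that x mult_strict_mono[of "norm x" 1 "norm u" 1] by (simp add: norm_mult)
  have comb: "(1 - of_real t) * g u + of_real t * g (x * u) \<in> g ` unit_disc"
    if "u \<in> unit_disc" "0 \<le> t" "t \<le> 1" for u t
    using convexD_alt[OF conv, of "g u" "g (x * u)" t] that mem
    by (simp add: scaleR_conv_of_real)
  define c where "c t = k ((1 - of_real t) * g z + of_real t * g (x * z))" for t
  have le: "norm (c t) \<le> norm z" if t: "0 \<le> t" "t \<le> 1" for t
  proof -
    have "norm (k ((1 - of_real t) * g z + of_real t * g (x * z))) \<le> norm z"
    proof (rule Schwarz_Lemma(1)[where f = "\<lambda>u. k ((1 - of_real t) * g u + of_real t * g (x * u))"])
      have "(\<lambda>u. g (x * u)) holomorphic_on unit_disc"
        using mem by (intro holomorphic_on_compose_gen[OF _ hol, unfolded o_def] holomorphic_intros) auto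
      then have "(\<lambda>u. (1 - of_real t) * g u + of_real t * g (x * u)) holomorphic_on unit_disc"
        by (intro holomorphic_intros hol)
      then show "(\<lambda>u. k ((1 - of_real t) * g u + of_real t * g (x * u))) holomorphic_on unit_disc"
        by (rule holomorphic_on_compose_gen[OF _ k_hol, unfolded o_def]) (use comb t in auto)
      show "k ((1 - of_real t) * g 0 + of_real t * g (x * 0)) = 0"
        using k[of 0] by (simp add: g0)
      fix u :: complex assume "norm u < 1"
      then show "norm (k ((1 - of_real t) * g u + of_real t * g (x * u))) < 1"
        using comb[of u t] t k by auto
    qed (use z in auto)
    then show ?thesis by (simp add: c_def)
  qed
  have gz: "deriv g z \<noteq> 0"
    using k_der[OF z(1)] by auto
  have "(k has_field_derivative 1 / deriv g z) (at (g z))"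
  proof -
    have "(k has_field_derivative deriv k (g z)) (at (g z))"
      using k_hol D_open z by (intro holomorphic_derivI) auto
    moreover have "deriv k (g z) = 1 / deriv g z"
      using k_der[OF z(1)] gz by (simp add: field_simps)
    ultimately show ?thesis by simp
  qed
  moreover have "((\<lambda>t. (1 - of_real t) * g z + of_real t * g (x * z))
      has_vector_derivative (g (x * z) - g z)) (at (0::real))"
    by (auto intro!: derivative_eq_intros)
  ultimately have "(c has_vector_derivative ((g (x * z) - g z) * (1 / deriv g z))) (at 0)"
    unfolding c_def using field_vector_diff_chain_at
    by (fastforce simp: o_def)
  moreover have c0: "c 0 = z"
    using k z by (simp add: c_def)
  moreover have "eventually (\<lambda>t. norm (c t) \<le> norm z) (at_right 0)"
    by (rule eventually_mono[OF eventually_at_right_real[of 0 1]]) (use le in auto)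
  ultimately have "inner z ((g (x * z) - g z) * (1 / deriv g z)) \<le> inner z 0"
    using inner_deriv_le_of_norm_le[of c _ "\<lambda>_. z" 0] by auto
  moreover have "(g (x * z) - g z) * (1 / deriv g z) = z * (- ((g z - g (x * z)) / (z * deriv g z)))"
    using gz z by (simp add: field_simps)
  ultimately have "(cmod z)\<^sup>2 * Re (- ((g z - g (x * z)) / (z * deriv g z))) \<le> 0"
    by (simp only: inner_mult_left_cnj inner_zero_right)
  then show ?thesis
    using z by (simp add: mult_le_0_iff zero_le_mult_iff)
qed

lemma holomorphic_on_quotient_at_0:
  assumes "f holomorphic_on unit_disc" and "f 0 = 0" and "deriv f 0 = c"
  shows "(\<lambda>z. if z = 0 then c else f z / z) holomorphic_on unit_disc"
  by (rule pole_theorem_open_0[OF assms(1) open_ball, of 0]) (use assms in auto)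

text \<open>
  For fixed \<open>z\<close>, the chord inequality says that \<open>A x = (g(z) - g(xz)) / (z g'(z))\<close> maps the disc to
  the closed right half-plane; \<open>A\<close> vanishes at \<open>1\<close> with derivative \<open>-1\<close>, and
  \<open>1 / A 0 = z g'(z) / g(z)\<close>. The half-plane version of Julia's lemma then gives the bound on
  \<open>Re (1 / A 0)\<close>. Its hypothesis \<open>Re (A 0) > 0\<close> comes from applying the maximum principle to \<open>A 0\<close> as
  a function \<open>h\<close> of \<open>z\<close>, which takes the value \<open>1\<close> at the origin.
\<close>
lemma convex_order_half:
  assumes hol: "g holomorphic_on unit_disc" and g0: "g 0 = 0" and g1: "deriv g 0 = 1"
    and inj: "inj_on g unit_disc" and conv: "convex (g ` unit_disc)"
    and z: "z \<in> unit_disc" "z \<noteq> 0"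
  shows "1 / 2 \<le> Re (z * deriv g z / g z)"
proof -
  have reg: "deriv g u \<noteq> 0" if "u \<in> unit_disc" for u
    by (rule holomorphic_injective_imp_regular[OF hol open_ball inj that])
  define h where "h u = (if u = 0 then 1 else g u / u) / deriv g u" for u
  define A where "A x = (g z - g (x * z)) / (z * deriv g z)" for x
  have Re_h: "0 < Re (h u)" if "u \<in> unit_disc" for u
  proof (rule Re_pos_of_Re_nonneg[OF _ _ _ that])
    show "h holomorphic_on unit_disc"
      unfolding h_def
      by (intro holomorphic_on_divide holomorphic_on_quotient_at_0 holomorphic_deriv hol g0 g1 open_ball reg)
    show "0 \<le> Re (h u)" if "u \<in> unit_disc" for u
      using convex_chord_Re_nonneg[OF hol g0 inj conv that, of 0] g1
      by (cases "u = 0") (auto simp: h_def g0)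
  qed (simp add: h_def g1)
  have A0: "A 0 = h z"
    using z by (simp add: A_def h_def g0)
  have mem: "x * z \<in> unit_disc" if "x \<in> unit_disc" for x
    using that z mult_strict_mono[of "norm x" 1 "norm z" 1] by (simp add: norm_mult)
  have "(cmod (A 0))\<^sup>2 \<le> 2 * 1 * Re (A 0)"
  proof (rule Julia_half_plane)
    have "(\<lambda>x. g (x * z)) holomorphic_on unit_disc"
      using mem by (intro holomorphic_on_compose_gen[OF _ hol, unfolded o_def] holomorphic_intros) auto
    then show "A holomorphic_on unit_disc"
      unfolding A_def using z reg by (intro holomorphic_intros) auto
    show "0 \<le> Re (A x)" if "x \<in> unit_disc" for x
      unfolding A_def by (rule convex_chord_Re_nonneg[OF hol g0 inj conv z that])
    show "0 < Re (A 0)"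
      using Re_h z by (simp add: A0)
    have "((\<lambda>x. g (x * z)) has_field_derivative deriv g z * z) (at 1)"
    proof (rule DERIV_chain2[of g _ "\<lambda>x. x * z"])
      show "(g has_field_derivative deriv g z) (at (1 * z))"
        using holomorphic_derivI[OF hol open_ball z(1)] by simp
    qed (auto intro!: derivative_eq_intros)
    then have "(A has_field_derivative (0 - deriv g z * z) / (z * deriv g z)) (at 1)"
      unfolding A_def by (intro DERIV_cdivide DERIV_diff) auto
    then show "(A has_field_derivative - of_real 1) (at 1)"
      using z reg[OF z(1)] by simp
  qed (simp add: A_def)
  moreover have "z * deriv g z / g z = 1 / A 0"
    using z by (simp add: A0 h_def)
  moreover have "0 < (cmod (A 0))\<^sup>2"
    using Re_h[OF z(1)] by (auto simp: A0)
  ultimately have "1 / 2 \<le> Re (A 0) / (cmod (A 0))\<^sup>2"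
    by (simp add: le_divide_eq)
  then show ?thesis
    unfolding \<open>z * deriv g z / g z = 1 / A 0\<close> by (simp add: Re_divide')
qed

section \<open>The Marx--Strohhaecker inequality\<close>

text \<open>
  The idea of Jack's lemma: at a point \<open>z\<^sub>0\<close> where \<open>|w|\<close> is maximal on a disc around the origin, with
  value \<open>M\<close>, Schwarz' lemma gives \<open>|w(l z\<^sub>0)| \<le> M |l|\<close> for \<open>|l| < 1\<close>, with equality at \<open>l = 1\<close>. Moving \<open>l\<close>
  from \<open>1\<close> into the disc with velocity \<open>-d\<close> shows \<open>Re (k d) \<ge> Re d\<close> for \<open>k = z\<^sub>0 w'(z\<^sub>0) / w(z\<^sub>0)\<close>.
  The choice \<open>d = y / (y - 1)\<close> with \<open>y = w(z\<^sub>0)\<close> makes \<open>k d\<close> the quantity bounded in the hypothesis,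
  while \<open>M > 1\<close> would force \<open>Re d > 1/2\<close>.
\<close>
lemma Jack_bound:
  assumes hol: "w holomorphic_on unit_disc" and w0: "w 0 = 0"
    and le: "\<And>z. z \<in> unit_disc \<Longrightarrow> Re (z * deriv w z / (w z - 1)) \<le> 1 / 2"
    and z: "z \<in> unit_disc"
  shows "norm (w z) \<le> 1"
proof (rule ccontr)
  assume big: "\<not> norm (w z) \<le> 1"
  have sub: "cball 0 (norm z) \<subseteq> unit_disc"
    using z by auto
  have "continuous_on (cball 0 (norm z)) (\<lambda>u. norm (w u))"
    by (intro continuous_on_norm holomorphic_on_imp_continuous_on holomorphic_on_subset[OF hol sub])
  then obtain z0 where z0: "z0 \<in> cball 0 (norm z)"
    and max: "\<And>u. u \<in> cball 0 (norm z) \<Longrightarrow> norm (w u) \<le> norm (w z0)"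
    using continuous_attains_sup[of "cball 0 (norm z)" "\<lambda>u. norm (w u)"] by auto
  define y where "y = w z0"
  define M where "M = norm y"
  define d where "d = y / (y - 1)"
  have z0_disc: "z0 \<in> unit_disc"
    using z0 sub by blast
  have M: "1 < M"
    using max[of z] big by (simp add: M_def y_def)
  then have y1: "y \<noteq> 1" "y \<noteq> 0"
    by (auto simp: M_def)
  have d: "1 / 2 < Re d"
  proof -
    have "1 < M\<^sup>2"
      using M by (simp add: one_less_power)
    then have "(cmod (y - 1))\<^sup>2 < 2 * (Re y * Re (y - 1) + Im y * Im (y - 1))"
      unfolding M_def cmod_power2 by (simp add: power2_eq_square algebra_simps)
    moreover have "0 < (cmod (y - 1))\<^sup>2"
      using y1 by simp
    ultimately show ?thesis
      unfolding d_def Re_divide' by (simp add: less_divide_eq)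
  qed
  have radial: "norm (w (l * z0)) \<le> norm (of_real M * l)" if l: "norm l < 1" for l
  proof -
    have mem: "u * z0 \<in> cball 0 (norm z)" if "norm u < 1" for u
      using that z0 mult_mono[of "norm u" 1 "norm z0" "norm z"] by (simp add: norm_mult)
    have "norm (w (l * z0) / of_real M) \<le> norm l"
    proof (rule norm_le_of_norm_le_1[where f = "\<lambda>l. w (l * z0) / of_real M"])
      have "(\<lambda>u. w (u * z0)) holomorphic_on unit_disc"
        using mem sub by (intro holomorphic_on_compose_gen[OF _ hol, unfolded o_def] holomorphic_intros) auto
      then show "(\<lambda>u. w (u * z0) / of_real M) holomorphic_on unit_disc"
        using M by (intro holomorphic_intros) auto
      show "norm (w (u * z0) / of_real M) \<le> 1" if "u \<in> unit_disc" for u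
        using max[OF mem[of u]] that M by (simp add: norm_divide M_def y_def divide_le_eq)
    qed (use w0 l in auto)
    then show ?thesis
      using M by (simp add: norm_divide norm_mult divide_le_eq mult.commute)
  qed
  \<comment> \<open>Since \<open>2 Re d > 1\<close>, the point \<open>1 - t d\<close> lies in the unit disc for \<open>0 < t < 1 / |d|\<^sup>2\<close>.\<close>
  have small: "eventually (\<lambda>t. norm (1 - of_real t * d) < 1) (at_right (0::real))"
  proof -
    have pos: "0 < (norm d)\<^sup>2"
      using d by auto
    have "eventually (\<lambda>t. t \<in> {0<..<1 / (norm d)\<^sup>2}) (at_right 0)"
      using pos by (intro eventually_at_right_real) simp
    then show ?thesis
    proof eventually_elim
      case (elim t)
      have "t * (norm d)\<^sup>2 < 2 * Re d"
        using elim d pos by (simp add: field_simps)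
      then have "t * (t * (norm d)\<^sup>2) < t * (2 * Re d)"
        using elim by (intro mult_strict_left_mono) auto
      moreover have "(norm (1 - of_real t * d))\<^sup>2 = 1 - t * (2 * Re d) + t * (t * (norm d)\<^sup>2)"
        unfolding cmod_power2 by (simp add: power2_eq_square algebra_simps)
      ultimately have "(norm (1 - of_real t * d))\<^sup>2 < 1\<^sup>2"
        by simp
      then show ?case
        by (rule power2_less_imp_less) simp
    qed
  qed
  have "inner (w ((1 - of_real 0 * d) * z0)) ((- d * z0) * deriv w z0)
      \<le> inner (of_real M * (1 - of_real 0 * d)) (of_real M * (- d))"
  proof (rule inner_deriv_le_of_norm_le)
    have "(w has_field_derivative deriv w z0) (at ((1 - of_real (0::real) * d) * z0))"
      using holomorphic_derivI[OF hol open_ball z0_disc] by simp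
    moreover have "((\<lambda>t. (1 - of_real t * d) * z0) has_vector_derivative (- d * z0)) (at (0::real))"
      by (auto intro!: derivative_eq_intros)
    ultimately show "((\<lambda>t. w ((1 - of_real t * d) * z0)) has_vector_derivative ((- d * z0) * deriv w z0)) (at 0)"
      using field_vector_diff_chain_at by (fastforce simp: o_def)
    show "((\<lambda>t. of_real M * (1 - of_real t * d)) has_vector_derivative (of_real M * (- d))) (at (0::real))"
      by (auto intro!: derivative_eq_intros)
    show "norm (w ((1 - of_real 0 * d) * z0)) = norm (of_real M * (1 - of_real 0 * d))"
      by (simp add: M_def y_def)
    show "eventually (\<lambda>t. norm (w ((1 - of_real t * d) * z0)) \<le> norm (of_real M * (1 - of_real t * d)))
        (at_right 0)"
      using small by eventually_elim (rule radial)
  qed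
  moreover have "(- d * z0) * deriv w z0 = y * (- (z0 * deriv w z0 / (w z0 - 1)))"
    by (simp add: d_def y_def)
  moreover have "inner (of_real M * (1 - of_real 0 * d)) (of_real M * (- d)) = - (M\<^sup>2 * Re d)"
    by (simp add: inner_complex_def power2_eq_square)
  ultimately have "inner y (y * (- (z0 * deriv w z0 / (w z0 - 1)))) \<le> - (M\<^sup>2 * Re d)"
    by (simp add: y_def)
  then have "M\<^sup>2 * Re d \<le> M\<^sup>2 * Re (z0 * deriv w z0 / (w z0 - 1))"
    unfolding inner_mult_left_cnj M_def by simp
  then have "Re d \<le> Re (z0 * deriv w z0 / (w z0 - 1))"
    using M by simp
  with d le[OF z0_disc] show False
    by linarith
qed

text \<open>
  With \<open>G(z) = g(z)/z\<close>, the claim is equivalent to \<open>|1 - 1/G| \<le> 1\<close>. For \<open>w = 1 - 1/G\<close> one computes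
  \<open>z w' / (w - 1) = 1 - z g'/g\<close>, so that starlikeness of order one half is exactly the hypothesis of
  the bound for \<open>w\<close>.
\<close>
lemma convex_quotient_Re_ge_half:
  assumes hol: "g holomorphic_on unit_disc" and g0: "g 0 = 0" and g1: "deriv g 0 = 1"
    and inj: "inj_on g unit_disc" and conv: "convex (g ` unit_disc)"
    and z: "z \<in> unit_disc"
  shows "1 / 2 \<le> Re (if z = 0 then 1 else g z / z)"
proof -
  define G where "G u = (if u = 0 then 1 else g u / u)" for u
  define w where "w u = 1 - 1 / G u" for u
  have G_hol: "G holomorphic_on unit_disc"
    unfolding G_def by (rule holomorphic_on_quotient_at_0[OF hol g0 g1])
  have G_nz: "G u \<noteq> 0" if "u \<in> unit_disc" for u
    using inj_onD[OF inj, of u 0] that by (auto simp: G_def g0)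
  have le: "norm (w z) \<le> 1"
  proof (rule Jack_bound[OF _ _ _ z])
    show "w holomorphic_on unit_disc"
      unfolding w_def using G_nz by (intro holomorphic_intros G_hol) auto
    show "w 0 = 0"
      by (simp add: w_def G_def)
    show "Re (u * deriv w u / (w u - 1)) \<le> 1 / 2" if u: "u \<in> unit_disc" for u
    proof (cases "u = 0")
      case False
      have "(w has_field_derivative - ((deriv g u * u - g u) / u\<^sup>2) * - 1 / (g u / u)\<^sup>2 ) (at u)"
      proof (rule has_field_derivative_transform_within_open[where S = "unit_disc - {0}"])
        show "((\<lambda>u. 1 - 1 / (g u / u)) has_field_derivative - ((deriv g u * u - g u) / u\<^sup>2) * - 1 / (g u / u)\<^sup>2) (at u)"
          using False G_nz[OF u] holomorphic_derivI[OF hol open_ball u]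
          by (auto intro!: derivative_eq_intros simp: G_def power2_eq_square field_simps)
      qed (use u False in \<open>auto simp: w_def G_def\<close>)
      from DERIV_imp_deriv[OF this] have "deriv w u = (deriv g u * u - g u) / (g u)\<^sup>2"
        using False by (simp add: power_divide)
      then have "u * deriv w u / (w u - 1) = u * ((deriv g u * u - g u) / (g u)\<^sup>2) / - (u / g u)"
        using False by (simp add: w_def G_def)
      also have "\<dots> = 1 - u * deriv g u / g u"
        using False G_nz[OF u] by (simp add: G_def field_simps power2_eq_square)
      finally have "u * deriv w u / (w u - 1) = 1 - u * deriv g u / g u" .
      then show ?thesis
        using convex_order_half[OF hol g0 g1 inj conv u False] by simp
    qed simp
  qed
  define q where "q = 1 / G z"
  have q: "q \<noteq> 0" "G z = 1 / q"
    using G_nz[OF z] by (auto simp: q_def)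
  have "(cmod (1 - q))\<^sup>2 \<le> 1\<^sup>2"
    using le by (intro power_mono) (auto simp: w_def q_def)
  then have "(cmod q)\<^sup>2 \<le> 2 * Re q"
    unfolding cmod_power2 by (simp add: power2_eq_square algebra_simps)
  then have "1 / 2 \<le> Re (1 / q)"
    using q by (simp add: Re_divide' field_simps)
  then show ?thesis
    using q by (simp add: G_def)
qed

section \<open>Convolution as a weighted average\<close>

lemma fps_expansion_sums_on_disc:
  assumes hol: "f holomorphic_on unit_disc" and z: "z \<in> unit_disc"
  shows "(\<lambda>n. fps_nth (fps_expansion f 0) n * z ^ n) sums f z"
  using has_fps_expansion_imp_sums_complex[of f _ 1 z] has_fps_expansion_fps_expansion[OF open_ball _ hol]
    hol z by (simp add: one_ereal_def)

text \<open>
  Expanding \<open>G(z/w)\<close> in powers of \<open>z/w\<close>, uniformly convergent on the circle since \<open>|z/w| = |z|/r < 1\<close>,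
  and integrating term by term, Cauchy's formula produces the Taylor coefficients of \<open>F\<close>.
\<close>
lemma hadamard_contour_integral:
  assumes F: "F holomorphic_on unit_disc" and G: "G holomorphic_on unit_disc"
    and z: "norm z < r" and r: "r < 1"
  shows "(\<lambda>w. F w * G (z / w) / w) contour_integrable_on circlepath 0 r"
    and "(\<lambda>n. fps_nth (fps_expansion F 0) n * fps_nth (fps_expansion G 0) n * z ^ n) sums
      (contour_integral (circlepath 0 r) (\<lambda>w. F w * G (z / w) / w) / (2 * pi * \<i>))"
proof -
  define a where "a = fps_nth (fps_expansion F 0)"
  define b where "b = fps_nth (fps_expansion G 0)"
  define p where "p n w = F w / w * (\<Sum>k<n. b k * (z / w) ^ k)" for n w
  have r0: "0 < r"
    using z norm_ge_zero[of z] by linarith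
  have sub: "cball 0 r \<subseteq> unit_disc"
    using r by auto
  have F_cont: "continuous_on (cball 0 r) F"
    by (intro holomorphic_on_imp_continuous_on holomorphic_on_subset[OF F sub])
  have quot: "z / w \<in> unit_disc" if "w \<in> sphere 0 r" for w
    using that z r0 by (simp add: norm_divide)
  have p_int: "(p n has_contour_integral (\<Sum>k<n. 2 * pi * \<i> * (a k * b k * z ^ k))) (circlepath 0 r)" for n
  proof -
    have "((\<lambda>w. F w / (w - 0) ^ Suc k) has_contour_integral (2 * pi * \<i> / fact k * (deriv ^^ k) F 0))
        (circlepath 0 r)" for k
      using r0 sub by (intro Cauchy_has_contour_integral_higher_derivative_circlepath F_cont
          holomorphic_on_subset[OF F]) auto
    then have "((\<lambda>w. (b k * z ^ k) * (F w / (w - 0) ^ Suc k)) has_contour_integral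
        (b k * z ^ k) * (2 * pi * \<i> / fact k * (deriv ^^ k) F 0)) (circlepath 0 r)" for k
      by (rule has_contour_integral_lmul)
    then have "((\<lambda>w. \<Sum>k<n. (b k * z ^ k) * (F w / (w - 0) ^ Suc k)) has_contour_integral
        (\<Sum>k<n. (b k * z ^ k) * (2 * pi * \<i> / fact k * (deriv ^^ k) F 0))) (circlepath 0 r)"
      by (intro has_contour_integral_sum) auto
    moreover have "(\<Sum>k<n. (b k * z ^ k) * (2 * pi * \<i> / fact k * (deriv ^^ k) F 0))
        = (\<Sum>k<n. 2 * pi * \<i> * (a k * b k * z ^ k))"
      by (intro sum.cong) (auto simp: a_def fps_expansion_def)
    moreover have "(\<Sum>k<n. (b k * z ^ k) * (F w / (w - 0) ^ Suc k)) = p n w" for w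
      by (simp add: p_def sum_distrib_left power_divide mult_ac)
    ultimately show ?thesis by simp
  qed
  have lim: "uniform_limit (sphere 0 r) p (\<lambda>w. F w / w * G (z / w)) sequentially"
    unfolding p_def
  proof (rule uniform_lim_mult)
    have "1 \<le> conv_radius b"
      using holomorphic_on_imp_fps_conv_radius_ge[of G "fps_expansion G 0" 1]
        has_fps_expansion_fps_expansion[OF open_ball _ G] G
      by (simp add: b_def fps_conv_radius_def one_ereal_def)
    moreover have "ereal (norm z / r) < 1"
      using z r0 by simp
    ultimately have "ereal (norm z / r) < conv_radius b"
      by (rule less_le_trans[rotated])
    from powser_uniform_limit[OF this, of 0]
    have "uniform_limit (cball 0 (norm z / r)) (\<lambda>n x. \<Sum>k<n. b k * x ^ k) (\<lambda>x. \<Sum>k. b k * x ^ k) sequentially"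
      by simp
    moreover have "(\<lambda>w. z / w) \<in> sphere 0 r \<rightarrow> cball 0 (norm z / r)"
      by (auto simp: norm_divide)
    ultimately have "uniform_limit (sphere 0 r) (\<lambda>n w. \<Sum>k<n. b k * (z / w) ^ k)
        (\<lambda>w. \<Sum>k. b k * (z / w) ^ k) sequentially"
      by (rule uniform_limit_compose')
    moreover have "(\<Sum>k. b k * (z / w) ^ k) = G (z / w)" if "w \<in> sphere 0 r" for w
      using fps_expansion_sums_on_disc[OF G quot[OF that]] by (simp add: b_def sums_iff)
    ultimately show "uniform_limit (sphere 0 r) (\<lambda>n w. \<Sum>k<n. b k * (z / w) ^ k)
        (\<lambda>w. G (z / w)) sequentially"
      by (subst (asm) uniform_limit_cong') (rule refl, assumption)
    show "bounded ((\<lambda>w. F w / w) ` sphere 0 r)"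
      using r0 by (intro compact_imp_bounded compact_continuous_image continuous_intros
          continuous_on_subset[OF F_cont]) auto
    have "continuous_on (sphere 0 r) (\<lambda>w. G (z / w))"
      using r0 quot by (intro continuous_on_compose2[OF holomorphic_on_imp_continuous_on[OF G]]
          continuous_intros) auto
    then show "bounded ((\<lambda>w. G (z / w)) ` sphere 0 r)"
      by (intro compact_imp_bounded compact_continuous_image) auto
  qed (intro uniform_limit_const)
  have eq: "(\<lambda>w. F w / w * G (z / w)) = (\<lambda>w. F w * G (z / w) / w)"
    by auto
  have int: "\<forall>\<^sub>F n in sequentially. p n contour_integrable_on circlepath 0 r"
    by (intro always_eventually allI has_contour_integral_integrable[OF p_int])
  note * = contour_integral_uniform_limit_circlepath[OF int lim trivial_limit_sequentially r0, unfolded eq]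
  show "(\<lambda>w. F w * G (z / w) / w) contour_integrable_on circlepath 0 r"
    by (rule *)
  have "(\<lambda>k. 2 * pi * \<i> * (a k * b k * z ^ k)) sums
      contour_integral (circlepath 0 r) (\<lambda>w. F w * G (z / w) / w)"
    using *(2) contour_integral_unique[OF p_int] by (simp add: sums_def)
  from sums_divide[OF this, of "2 * pi * \<i>"]
  show "(\<lambda>n. fps_nth (fps_expansion F 0) n * fps_nth (fps_expansion G 0) n * z ^ n) sums
      (contour_integral (circlepath 0 r) (\<lambda>w. F w * G (z / w) / w) / (2 * pi * \<i>))"
    by (simp add: a_def b_def)
qed

lemma hadamard_summable:
  assumes "F holomorphic_on unit_disc" and "G holomorphic_on unit_disc" and "z \<in> unit_disc"
  shows "summable (\<lambda>n. fps_nth (fps_expansion F 0) n * fps_nth (fps_expansion G 0) n * z ^ n)"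
proof -
  from assms(3) obtain r where "norm z < r" "r < 1"
    using dense[of "norm z" 1] by auto
  then show ?thesis
    using hadamard_contour_integral(2)[OF assms(1,2)] sums_summable by blast
qed

text \<open>
  On the circle \<open>|w| = r\<close>, the function \<open>cnj (G (z/w))\<close> agrees with a function holomorphic in \<open>w\<close>,
  because \<open>cnj (z/w) = cnj z * w / r\<^sup>2\<close> there; its value at \<open>w = 0\<close> is \<open>cnj (G 0) = 1\<close>. Hence adding
  \<open>cnj (G (z/w)) - 1\<close> to \<open>G (z/w)\<close> does not change the mean of \<open>F(w) G(z/w)\<close> over the circle. The
  convolution is thus the mean of \<open>F(w)\<close> weighted with the nonnegative real number
  \<open>2 Re (G (z/w)) - 1\<close>.
\<close>
lemma Re_hadamard_nonneg:
  assumes F: "F holomorphic_on unit_disc" and G: "G holomorphic_on unit_disc"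
    and F_pos: "\<And>w. w \<in> unit_disc \<Longrightarrow> 0 \<le> Re (F w)"
    and G_half: "\<And>w. w \<in> unit_disc \<Longrightarrow> 1 / 2 \<le> Re (G w)" and G0: "G 0 = 1"
    and z: "z \<in> unit_disc"
  shows "0 \<le> Re (\<Sum>n. fps_nth (fps_expansion F 0) n * fps_nth (fps_expansion G 0) n * z ^ n)"
proof -
  define S where "S = (\<Sum>n. fps_nth (fps_expansion F 0) n * fps_nth (fps_expansion G 0) n * z ^ n)"
  from z obtain r where r: "norm z < r" "r < 1"
    using dense[of "norm z" 1] by auto
  have r0: "0 < r"
    using r norm_ge_zero[of z] by linarith
  have S: "((\<lambda>w. F w * G (z / w) / w) has_contour_integral 2 * pi * \<i> * S) (circlepath 0 r)"
    using hadamard_contour_integral[OF F G r] has_contour_integral_integral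
    by (fastforce simp: S_def sums_iff)
  \<comment> \<open>On the circle, \<open>K w = F w * (cnj (G (z / w)) - 1)\<close>; conjugating twice keeps it holomorphic.\<close>
  define K where "K w = F w * (cnj (G (cnj (cnj z * w / (of_real r)\<^sup>2))) - 1)" for w
  have "K holomorphic_on cball 0 r"
  proof -
    have refl: "(\<lambda>u. cnj (G (cnj u))) holomorphic_on unit_disc"
    proof -
      have "cnj ` unit_disc = unit_disc"
        by (auto simp: image_iff intro!: bexI[of _ "cnj _"])
      then show ?thesis
        using holomorphic_on_compose_cnj_cnj[of G unit_disc] G by (simp add: o_def)
    qed
    have mem: "cnj z * w / (of_real r)\<^sup>2 \<in> unit_disc" if "w \<in> cball 0 r" for w
    proof -
      have "norm z * norm w \<le> norm z * r"
        using that by (intro mult_left_mono) auto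
      also have "\<dots> < r * r"
        using r r0 by simp
      finally show ?thesis
        using r0 by (simp add: norm_divide norm_mult norm_power power2_eq_square)
    qed
    have "(\<lambda>w. cnj (G (cnj (cnj z * w / (of_real r)\<^sup>2)))) holomorphic_on cball 0 r"
      using mem r0 by (intro holomorphic_on_compose_gen[OF _ refl, unfolded o_def] holomorphic_intros) auto
    then show ?thesis
      unfolding K_def using r by (intro holomorphic_intros holomorphic_on_subset[OF F]) auto
  qed
  from Cauchy_integral_circlepath_simple[OF this, of 0] r0
  have "((\<lambda>w. K w / w) has_contour_integral 0) (circlepath 0 r)"
    by (simp add: K_def G0)
  with has_contour_integral_add[OF S]
  have "((\<lambda>w. F w * G (z / w) / w + K w / w) has_contour_integral 2 * pi * \<i> * S) (circlepath 0 r)"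
    by fastforce
  then have "((\<lambda>w. F w * of_real (2 * Re (G (z / w)) - 1) / w) has_contour_integral 2 * pi * \<i> * S) (circlepath 0 r)"
  proof (rule has_contour_integral_eq)
    fix w assume "w \<in> path_image (circlepath 0 r)"
    then have w: "norm w = r" "w \<noteq> 0"
      using r0 by auto
    have "cnj w * w = (of_real r)\<^sup>2"
      using complex_norm_square[of w] w by (simp add: mult.commute)
    moreover have "cnj (cnj z * w / (of_real r)\<^sup>2) = z * cnj w / (of_real r)\<^sup>2"
      by simp
    ultimately have "cnj (cnj z * w / (of_real r)\<^sup>2) = z * cnj w / (cnj w * w)"
      by metis
    also have "\<dots> = z / w"
      using w by simp
    finally have "cnj (cnj z * w / (of_real r)\<^sup>2) = z / w" .
    then have "K w = F w * (cnj (G (z / w)) - 1)"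
      by (simp add: K_def)
    then have "F w * G (z / w) / w + K w / w = (F w * G (z / w) + F w * (cnj (G (z / w)) - 1)) / w"
      by (simp add: add_divide_distrib)
    also have "F w * G (z / w) + F w * (cnj (G (z / w)) - 1) = F w * (G (z / w) + cnj (G (z / w)) - 1)"
      by (simp add: algebra_simps)
    also have "G (z / w) + cnj (G (z / w)) - 1 = of_real (2 * Re (G (z / w)) - 1)"
      by (simp add: complex_add_cnj)
    finally show "F w * G (z / w) / w + K w / w = F w * of_real (2 * Re (G (z / w)) - 1) / w" .
  qed
  then have integral: "((\<lambda>t. F (circlepath 0 r t) * of_real (2 * Re (G (z / circlepath 0 r t)) - 1)
      / circlepath 0 r t * vector_derivative (circlepath 0 r) (at t within {0..1}))
      has_integral (2 * pi * \<i> * S)) {0..1}"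
    by (simp add: has_contour_integral_def)
  have "((\<lambda>t. 2 * pi * \<i> * (F (circlepath 0 r t) * of_real (2 * Re (G (z / circlepath 0 r t)) - 1)))
      has_integral (2 * pi * \<i> * S)) {0..1}"
  proof (rule has_integral_eq[OF _ integral])
    fix t :: real assume t: "t \<in> {0..1}"
    have "vector_derivative (circlepath 0 r) (at t within {0..1}) = 2 * pi * \<i> * circlepath 0 r t"
      using t by (simp add: vector_derivative_circlepath01) (simp add: circlepath)
    moreover have "circlepath 0 r t \<noteq> 0"
      using r0 by (simp add: circlepath)
    ultimately show "F (circlepath 0 r t) * of_real (2 * Re (G (z / circlepath 0 r t)) - 1)
        / circlepath 0 r t * vector_derivative (circlepath 0 r) (at t within {0..1})
        = 2 * pi * \<i> * (F (circlepath 0 r t) * of_real (2 * Re (G (z / circlepath 0 r t)) - 1))"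
      by simp
  qed
  from has_integral_mult_right[OF this, of "1 / (2 * pi * \<i>)"]
  have "((\<lambda>t. F (circlepath 0 r t) * of_real (2 * Re (G (z / circlepath 0 r t)) - 1)) has_integral S) {0..1}"
    by simp
  then have "0 \<le> Re S"
  proof (rule has_integral_nonneg[OF has_integral_Re])
    fix t :: real
    have "norm (circlepath 0 r t) = r"
      using r0 by (simp add: circlepath norm_mult)
    then have "0 \<le> Re (F (circlepath 0 r t)) * (2 * Re (G (z / circlepath 0 r t)) - 1)"
      using F_pos[of "circlepath 0 r t"] G_half[of "z / circlepath 0 r t"] r r0
      by (intro mult_nonneg_nonneg) (auto simp: norm_divide)
    then show "0 \<le> Re (F (circlepath 0 r t) * of_real (2 * Re (G (z / circlepath 0 r t)) - 1))"
      by simp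
  qed
  then show ?thesis
    by (simp add: S_def)
qed

section \<open>Invariance of the class under convolution with convex functions\<close>

lemma fps_nth_quotient_at_0:
  assumes f: "f \<in> normalized_functions"
  shows "fps_nth (fps_expansion (\<lambda>z. if z = 0 then 1 else f z / z) 0) n = fps_nth (fps_expansion f 0) (Suc n)"
proof -
  define a where "a = fps_expansion f 0"
  have f': "f holomorphic_on unit_disc" "f 0 = 0" "deriv f 0 = 1"
    using f by (auto simp: normalized_functions_def)
  have exp: "f has_fps_expansion a"
    unfolding a_def using f' by (intro has_fps_expansion_fps_expansion[OF open_ball]) auto
  have a: "fps_nth a 0 = 0" "fps_nth a 1 = 1"
    using f' fps_nth_fps_expansion[OF exp, of 0] fps_nth_fps_expansion[OF exp, of 1] by auto
  then have "1 \<le> subdegree a"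
    by (intro subdegree_geI) auto
  from has_fps_expansion_shift[OF exp this, of 1] a
  have "(\<lambda>z. if z = 0 then 1 else f z / z) has_fps_expansion fps_shift 1 a"
    by (simp cong: if_cong)
  from fps_expansion_eqI[OF this] show ?thesis
    by (simp add: a_def)
qed

definition A_functional :: "real \<Rightarrow> (complex \<Rightarrow> complex) \<Rightarrow> complex \<Rightarrow> complex" where
  "A_functional \<beta> f z =
     of_real \<beta> * (if z = 0 then 1 else f z / z) + of_real (1 - \<beta>) * deriv f z"

lemma class_A_iff:
  "f \<in> class_A \<beta> \<longleftrightarrow>
     f \<in> normalized_functions \<and> (\<forall>z\<in>unit_disc. 0 < Re (A_functional \<beta> f z))"
  unfolding class_A_def A_functional_def by simp

lemma A_functional_holomorphic:
  assumes "f \<in> normalized_functions"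
  shows "A_functional \<beta> f holomorphic_on unit_disc"
  unfolding A_functional_def using assms
  by (intro holomorphic_intros holomorphic_on_quotient_at_0 holomorphic_deriv)
    (auto simp: normalized_functions_def)

lemma A_functional_0:
  assumes "f \<in> normalized_functions"
  shows "A_functional \<beta> f 0 = 1"
  using assms by (simp add: A_functional_def normalized_functions_def)

text \<open>
  The functional acts diagonally on Taylor coefficients; this is why it commutes with convolution.
\<close>
lemma fps_nth_A_functional:
  assumes f: "f \<in> normalized_functions"
  shows "fps_nth (fps_expansion (A_functional \<beta> f) 0) n =
    of_real (\<beta> + (1 - \<beta>) * (n + 1)) * fps_nth (fps_expansion f 0) (Suc n)"
proof -
  define q where "q = (\<lambda>z. if z = 0 then 1 else f z / z)"
  have hol: "f holomorphic_on unit_disc" "q holomorphic_on unit_disc"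
    using f holomorphic_on_quotient_at_0[of f 1] by (auto simp: normalized_functions_def q_def)
  have "f has_fps_expansion fps_expansion f 0" "q has_fps_expansion fps_expansion q 0"
    using hol by (intro has_fps_expansion_fps_expansion[OF open_ball]; simp)+
  moreover have "A_functional \<beta> f = (\<lambda>z. of_real \<beta> * q z + of_real (1 - \<beta>) * deriv f z)"
    by (simp add: A_functional_def q_def fun_eq_iff)
  ultimately have "A_functional \<beta> f has_fps_expansion
      fps_const (of_real \<beta>) * fps_expansion q 0 + fps_const (of_real (1 - \<beta>)) * fps_deriv (fps_expansion f 0)"
    by (simp only:) (intro fps_expansion_intros)
  from fps_expansion_eqI[OF this] show ?thesis
    using fps_nth_quotient_at_0[OF f, of n] by (simp add: q_def algebra_simps)
qed

lemma hadamard_product_normalized: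
  assumes f: "f \<in> normalized_functions" and g: "g \<in> normalized_functions"
  shows "hadamard_product f g \<in> normalized_functions"
    and "fps_nth (fps_expansion (hadamard_product f g) 0) n =
      fps_nth (fps_expansion f 0) n * fps_nth (fps_expansion g 0) n"
proof -
  define P where "P = Abs_fps (\<lambda>n. fps_nth (fps_expansion f 0) n * fps_nth (fps_expansion g 0) n)"
  have hol: "f holomorphic_on unit_disc" "g holomorphic_on unit_disc"
    using f g by (auto simp: normalized_functions_def)
  have eq: "hadamard_product f g = eval_fps P"
    by (auto simp: hadamard_product_def eval_fps_def P_def)
  have rad: "1 \<le> fps_conv_radius P"
    unfolding fps_conv_radius_def
    by (rule conv_radius_geI_ex') (use hadamard_summable[OF hol] in \<open>auto simp: P_def one_ereal_def\<close>)
  then have exp: "hadamard_product f g has_fps_expansion P"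
    unfolding eq by (intro eval_fps_has_fps_expansion) (auto intro: less_le_trans[of 0 1])
  show coeff: "fps_nth (fps_expansion (hadamard_product f g) 0) n =
      fps_nth (fps_expansion f 0) n * fps_nth (fps_expansion g 0) n" for n
    using fps_expansion_eqI[OF exp] by (simp add: P_def)
  have "hadamard_product f g holomorphic_on unit_disc"
    unfolding eq
  proof (rule holomorphic_on_eval_fps)
    show "unit_disc \<subseteq> eball 0 (fps_conv_radius P)"
    proof
      fix z :: complex assume "z \<in> unit_disc"
      then have "ereal (norm z) < 1" by simp
      then show "z \<in> eball 0 (fps_conv_radius P)"
        using less_le_trans[OF _ rad] by simp
    qed
  qed
  moreover have "hadamard_product f g 0 = 0" "deriv (hadamard_product f g) 0 = 1"
    using coeff[of 0] coeff[of 1] f g by (auto simp: fps_expansion_def normalized_functions_def)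
  ultimately show "hadamard_product f g \<in> normalized_functions"
    by (simp add: normalized_functions_def)
qed

theorem theorem2p6:
  fixes \<beta> :: real and f g :: "complex \<Rightarrow> complex"
  assumes "0 \<le> \<beta>" and "\<beta> \<le> 1"
    and "f \<in> class_A \<beta>"
    and "g \<in> convex_functions"
  shows "hadamard_product f g \<in> class_A \<beta>"
proof -
  define h where "h = hadamard_product f g"
  define G where "G = (\<lambda>z. if z = 0 then 1 else g z / z)"
  have f: "f \<in> normalized_functions" "\<And>z. z \<in> unit_disc \<Longrightarrow> 0 < Re (A_functional \<beta> f z)"
    using assms(3) by (auto simp: class_A_iff)
  have g: "g \<in> normalized_functions" "g holomorphic_on unit_disc" "g 0 = 0" "deriv g 0 = 1"
    "inj_on g unit_disc" "convex (g ` unit_disc)"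
    using assms(4) by (auto simp: convex_functions_def normalized_functions_def)
  have h: "h \<in> normalized_functions"
    unfolding h_def by (rule hadamard_product_normalized[OF f(1) g(1)])
  have coeff: "fps_nth (fps_expansion (A_functional \<beta> h) 0) n =
      fps_nth (fps_expansion (A_functional \<beta> f) 0) n * fps_nth (fps_expansion G 0) n" for n
    using hadamard_product_normalized(2)[OF f(1) g(1), of "Suc n"]
    by (simp add: fps_nth_A_functional h f g fps_nth_quotient_at_0 G_def flip: h_def)
  have nonneg: "0 \<le> Re (A_functional \<beta> h z)" if z: "z \<in> unit_disc" for z
  proof -
    have "0 \<le> Re (\<Sum>n. fps_nth (fps_expansion (A_functional \<beta> f) 0) n * fps_nth (fps_expansion G 0) n * z ^ n)"
    proof (rule Re_hadamard_nonneg)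
      show "G holomorphic_on unit_disc"
        unfolding G_def by (rule holomorphic_on_quotient_at_0[OF g(2-4)])
      show "1 / 2 \<le> Re (G w)" if "w \<in> unit_disc" for w
        unfolding G_def by (rule convex_quotient_Re_ge_half[OF g(2-6) that])
    qed (use f z in \<open>auto simp: G_def less_imp_le intro: A_functional_holomorphic\<close>)
    also have "(\<Sum>n. fps_nth (fps_expansion (A_functional \<beta> f) 0) n * fps_nth (fps_expansion G 0) n * z ^ n)
        = A_functional \<beta> h z"
      using fps_expansion_sums_on_disc[OF A_functional_holomorphic[OF h] z, of \<beta>]
      by (simp add: coeff sums_iff)
    finally show ?thesis .
  qed
  have "0 < Re (A_functional \<beta> h z)" if "z \<in> unit_disc" for z
    by (rule Re_pos_of_Re_nonneg[OF A_functional_holomorphic[OF h] nonneg _ that])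
      (simp_all add: A_functional_0[OF h])
  with h show ?thesis
    by (simp add: class_A_iff h_def)
qed

end
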